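(* Let $\alpha \ge 1$ be a fixed integer. For each integer $n \ge 1$, consider a multi-agent workflow with $n$ steps in which every step has exactly $\alpha$ available options, and let $\eta(n) = \mathcal{S}_{\mathrm{std}}(n)/\mathcal{S}_{\mathrm{rollback}}(n)$ be its efficiency, i.e. the ratio of the total number of steps required to generate all possible final results without a rollback mechanism to the total number required with a rollback mechanism. Then $$\lim_{n\to\infty} \frac{\eta(n)}{n} = \frac{\alpha-1}{\alpha} .$$
   Context: A workflow with $n$ steps and $x_i$ options (tools or prompts) at step $i$ ($x_i$ a positive integer) is modelled by a rooted tree: the root is the initial input; each node at depth $i-1$ has exactly $x_i$ children at depth $i$, one for each option at step $i$, for $1 \le i \le n$. Leaves (nodes at depth $n$) are the possible final results, and each edge represents one execution of one step. Here $x_i = \alpha$ for all $i$. $\mathcal{S}_{\mathrm{std}}$ is the total number of step executions needed to generate all final results without rollback: for each leaf separately, the full root-to-leaf path is executed from the root, and the lengths of all these paths are added up. $\mathcal{S}_{\mathrm{rollback}}$ is the total number of step executions needed with rollback: every intermediate node is stored as a checkpoint from which execution may be resumed, so each edge of the tree is executed exactly once, and $\mathcal{S}_{\mathrm{rollback}}$ is the number of edges of the tree. *)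

theory Defs
  imports Complex_Main
begin

text \<open>
  Step \<open>i\<close> (for \<open>i \<ge> 1\<close>) has \<open>x i\<close> options, numbered \<open>0, \<dots>, x i - 1\<close>.  A node of the
  workflow tree is the list of the options chosen so far, so the root is \<open>[]\<close>, the depth of a
  node is its length, and the parent of \<open>u @ [c]\<close> is \<open>u\<close>.  List positions count from 0,
  hence the shift in \<open>x (Suc j)\<close>.
\<close>

definition nodes_at :: "(nat \<Rightarrow> nat) \<Rightarrow> nat \<Rightarrow> nat list set" where
  "nodes_at x i = {v. length v = i \<and> (\<forall>j<i. v ! j < x (Suc j))}"

definition edges :: "(nat \<Rightarrow> nat) \<Rightarrow> nat \<Rightarrow> (nat list \<times> nat list) set" where
  "edges x n = {(u, u @ [c]) | i u c. i \<in> {1..n} \<and> u \<in> nodes_at x (i - 1) \<and> c < x i}"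

definition leaves :: "(nat \<Rightarrow> nat) \<Rightarrow> nat \<Rightarrow> nat list set" where
  "leaves x n = nodes_at x n"

definition root_path :: "nat list \<Rightarrow> (nat list \<times> nat list) list" where
  "root_path v = map (\<lambda>k. (take k v, take (Suc k) v)) [0..<length v]"

definition S_std :: "(nat \<Rightarrow> nat) \<Rightarrow> nat \<Rightarrow> nat" where
  "S_std x n = (\<Sum>v\<in>leaves x n. length (root_path v))"

definition S_rollback :: "(nat \<Rightarrow> nat) \<Rightarrow> nat \<Rightarrow> nat" where
  "S_rollback x n = card (edges x n)"

definition efficiency :: "(nat \<Rightarrow> nat) \<Rightarrow> nat \<Rightarrow> real" where
  "efficiency x n = real (S_std x n) / real (S_rollback x n)"

lemma card_children:
  assumes "i \<in> {1..n}" "u \<in> nodes_at x (i - 1)"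
  shows "card {v. (u, v) \<in> edges x n} = x i"
proof -
  have "{v. (u, v) \<in> edges x n} = (\<lambda>c. u @ [c]) ` {..<x i}"
  proof (intro equalityI subsetI)
    fix v assume "v \<in> {v. (u, v) \<in> edges x n}"
    then obtain k c where k: "k \<in> {1..n}" "u \<in> nodes_at x (k - 1)" "c < x k" "v = u @ [c]"
      by (auto simp: edges_def)
    have "k - 1 = i - 1" using k(2) assms(2) by (simp add: nodes_at_def)
    then have "k = i" using k(1) assms(1) by auto
    then show "v \<in> (\<lambda>c. u @ [c]) ` {..<x i}" using k by auto
  next
    fix v assume "v \<in> (\<lambda>c. u @ [c]) ` {..<x i}"
    then show "v \<in> {v. (u, v) \<in> edges x n}" using assms by (auto simp: edges_def)
  qed
  then show ?thesis by (simp add: card_image inj_on_def)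
qed

lemma root_path_in_tree:
  assumes "v \<in> leaves x n"
  shows "set (root_path v) \<subseteq> edges x n"
proof
  fix e assume "e \<in> set (root_path v)"
  then obtain k where k: "k < n" "e = (take k v, take (Suc k) v)"
    using assms by (auto simp: root_path_def leaves_def nodes_at_def)
  have "take (Suc k) v = take k v @ [v ! k]"
    using k assms by (simp add: take_Suc_conv_app_nth leaves_def nodes_at_def)
  moreover have "take k v \<in> nodes_at x (Suc k - 1)" "v ! k < x (Suc k)" "Suc k \<in> {1..n}"
    using k assms by (auto simp: leaves_def nodes_at_def)
  ultimately show "e \<in> edges x n" unfolding edges_def using k(2) by blast
qed

end

theory Submission
  imports Defs
begin

text \<open>
  With \<open>\<alpha>\<close> options everywhere, \<open>\<eta>(n) / n = \<alpha>\<^sup>n / (\<alpha> + \<dots> + \<alpha>\<^sup>n)\<close>, which is the reciprocal of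
  the \<open>n\<close>-th partial sum of the geometric series with ratio \<open>1 / \<alpha>\<close>. For \<open>\<alpha> \<ge> 2\<close> that series
  converges to \<open>\<alpha> / (\<alpha> - 1)\<close>; for \<open>\<alpha> = 1\<close> the partial sum is \<open>n\<close>.
\<close>

text \<open>With equal option counts the bound no longer depends on the position, so a level
  consists of all words of a fixed length over one alphabet, whose number is known.\<close>

lemma nodes_at_const: "nodes_at (\<lambda>_. a) i = {v. set v \<subseteq> {..<a} \<and> length v = i}"
  by (auto simp: nodes_at_def set_conv_nth)

lemma finite_nodes_at_const: "finite (nodes_at (\<lambda>_. a) i)"
  unfolding nodes_at_const by (rule finite_lists_length_eq) simp

lemma card_nodes_at_const: "card (nodes_at (\<lambda>_. a) i) = a ^ i"
  unfolding nodes_at_const by (simp add: card_lists_length_eq)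

lemma S_std_const: "S_std (\<lambda>_. a) n = n * a ^ n"
proof -
  have "S_std (\<lambda>_. a) n = (\<Sum>v\<in>nodes_at (\<lambda>_. a) n. n)"
    unfolding S_std_def leaves_def
    by (rule sum.cong) (auto simp: root_path_def nodes_at_def)
  then show ?thesis
    by (simp add: card_nodes_at_const)
qed

lemma snoc_in_nodes_at_iff:
  "u @ [c] \<in> nodes_at x (Suc i) \<longleftrightarrow> u \<in> nodes_at x i \<and> c < x (Suc i)"
  by (auto simp: nodes_at_def nth_append less_Suc_eq)

text \<open>An edge is determined by its child node.\<close>

lemma edges_eq_image: "edges x n = (\<lambda>v. (butlast v, v)) ` (\<Union>i\<in>{1..n}. nodes_at x i)"
proof (intro equalityI subsetI)
  fix e assume "e \<in> edges x n"
  then obtain i u c where "i \<in> {1..n}" "u \<in> nodes_at x (i - 1)" "c < x i" "e = (u, u @ [c])"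
    by (auto simp: edges_def)
  moreover from this have "u @ [c] \<in> nodes_at x i"
    using snoc_in_nodes_at_iff[of u c x "i - 1"] by simp
  ultimately show "e \<in> (\<lambda>v. (butlast v, v)) ` (\<Union>i\<in>{1..n}. nodes_at x i)"
    by (intro image_eqI[of _ _ "u @ [c]"]) auto
next
  fix e assume "e \<in> (\<lambda>v. (butlast v, v)) ` (\<Union>i\<in>{1..n}. nodes_at x i)"
  then obtain i v where i: "i \<in> {1..n}" and v: "v \<in> nodes_at x i" "e = (butlast v, v)"
    by auto
  \<comment> \<open>Depth at least 1 excludes the root, which has no parent although
    \<open>butlast []\<close> is defined.\<close>
  from i v(1) have "v \<noteq> []"
    by (auto simp: nodes_at_def)
  then obtain u c where u: "v = u @ [c]"
    by (cases v rule: rev_cases) auto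
  have "u \<in> nodes_at x (i - 1)" "c < x i"
    using snoc_in_nodes_at_iff[of u c x "i - 1"] i v(1) u by auto
  with i v(2) u show "e \<in> edges x n"
    by (auto simp: edges_def)
qed

text \<open>Counting edges by their child nodes reduces this to adding up the sizes of levels 1 to
  \<open>n\<close>, which are disjoint because depth is list length.\<close>

lemma S_rollback_const: "S_rollback (\<lambda>_. a) n = (\<Sum>i=1..n. a ^ i)"
proof -
  have "S_rollback (\<lambda>_. a) n = card (\<Union>i\<in>{1..n}. nodes_at (\<lambda>_. a) i)"
    unfolding S_rollback_def edges_eq_image by (intro card_image inj_onI) auto
  also have "\<dots> = (\<Sum>i=1..n. card (nodes_at (\<lambda>_. a) i))"
  proof (rule card_UN_disjoint)
    show "\<forall>i\<in>{1..n}. \<forall>j\<in>{1..n}. i \<noteq> j \<longrightarrow> nodes_at (\<lambda>_. a) i \<inter> nodes_at (\<lambda>_. a) j = {}"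
      by (auto simp: nodes_at_def)
  qed (simp_all add: finite_nodes_at_const)
  finally show ?thesis
    by (simp add: card_nodes_at_const)
qed

lemma efficiency_const:
  assumes "a \<ge> 1" "n \<ge> 1"
  shows "efficiency (\<lambda>_. a) n / real n = inverse (\<Sum>k<n. (1 / real a) ^ k)"
proof -
  \<comment> \<open>Summing from the deepest level upwards lets \<open>a ^ n\<close> factor out; it
    then cancels against the number of leaves.\<close>
  have "(\<Sum>i=1..n. real a ^ i) = (\<Sum>k<n. real a ^ (n - k))"
    by (rule sum.reindex_bij_witness[of _ "\<lambda>k. n - k" "\<lambda>i. n - i"]) auto
  also have "\<dots> = real a ^ n * (\<Sum>k<n. (1 / real a) ^ k)"
    using assms(1) by (simp add: sum_distrib_left power_diff power_divide)
  finally show ?thesis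
    using assms by (simp add: efficiency_def S_std_const S_rollback_const field_simps)
qed

theorem proposition2:
  fixes \<alpha> :: nat
  assumes "\<alpha> \<ge> 1"
  shows "(\<lambda>n. efficiency (\<lambda>i. \<alpha>) n / real n) \<longlonglongrightarrow> (real \<alpha> - 1) / real \<alpha>"
proof -
  have "(\<lambda>n. inverse (\<Sum>k<n. (1 / real \<alpha>) ^ k)) \<longlonglongrightarrow> (real \<alpha> - 1) / real \<alpha>"
  proof (cases "\<alpha> = 1")
    case True
    \<comment> \<open>The series diverges here, and the limit 0 comes from
      \<open>1 / n\<close>.\<close>
    then show ?thesis
      using lim_inverse_n[where 'a = real] by simp
  next
    case False
    with assms have "norm (1 / real \<alpha>) < 1"
      by simp
    then have "(\<lambda>n. \<Sum>k<n. (1 / real \<alpha>) ^ k) \<longlonglongrightarrow> 1 / (1 - 1 / real \<alpha>)"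
      using geometric_sums by (simp only: sums_def)
    \<comment> \<open>Inverting is continuous at this limit, which is nonzero since \<alpha> differs
      from 1.\<close>
    then have "(\<lambda>n. inverse (\<Sum>k<n. (1 / real \<alpha>) ^ k)) \<longlonglongrightarrow> inverse (1 / (1 - 1 / real \<alpha>))"
      using False assms by (intro tendsto_inverse) auto
    moreover have "inverse (1 / (1 - 1 / real \<alpha>)) = (real \<alpha> - 1) / real \<alpha>"
      using assms by (simp add: diff_divide_distrib)
    ultimately show ?thesis
      by simp
  qed
  moreover have "\<forall>\<^sub>F n in sequentially.
      inverse (\<Sum>k<n. (1 / real \<alpha>) ^ k) = efficiency (\<lambda>i. \<alpha>) n / real n"
    using eventually_ge_at_top[of 1] by eventually_elim (rule efficiency_const[OF assms, symmetric])
  ultimately show ?thesis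
    by (rule Lim_transform_eventually)
qed

end
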